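(* Let $(R,H)\in\mathcal{K}_{k,n,c}$ and let $\psi:\mathbb{R}^k\to\mathbb{R}^{n-k}$ be the function whose graph has basic representation $R$ (in the $n$-fold effective product of $(\mathcal{I}_{10,c},\iota)$). Then there exist partial recursive functionals $\kappa_1',\dots,\kappa_{n-k}'$ such that whenever $\phi_1,\dots,\phi_k$ are nested oracles for real numbers $x_1,\dots,x_k$ in $(\mathcal{I}_{10,c},\iota)$, for each $1\le j\le n-k$ the value $\kappa_j'(\phi_1,\dots,\phi_k,m)$ is defined for all $m\in\mathbb{N}$ and $m\mapsto\kappa_j'(\phi_1,\dots,\phi_k,m)$ is a nested oracle for $\varpi_j^{n-k}(\psi(x_1,\dots,x_k))$ in $(\mathcal{I}_{10,c},\iota)$.
   Context: Notation: $\mathbb{N}$ non-negative integers; Cantor pairing $\langle x,y\rangle=\frac12(x^2+2xy+y^2+3x+y)$, $\langle x_1,\dots,x_n\rangle=\langle\langle x_1,\dots,x_{n-1}\rangle,x_n\rangle$, $\pi_i^n\langle x_1,\dots,x_n\rangle=x_i$; $\varpi_i^n(x_1,\dots,x_n)=x_i$ on $\mathbb{R}^n$. Rationals are coded by a fixed computable injection $\rho$ into $\mathbb{N}$, $[a,b]:=\langle\rho(a),\rho(b)\rangle$, $\iota[a,b]=\{x\in\mathbb{R}:a<x<b\}$. For a positive rational $c$, $\mathcal{I}_{10,c}$ is the set of $\iota[a,b]$ with $a=\frac{m-c}{10^d}$, $b=\frac{m+1+c}{10^d}$ for an integer $m$ and positive integer $d$ ($d$ = number of digits of precision); $I=\mathrm{dom}_{\mathcal{I}_{10,c}}\iota$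 is the set of codes $[a,b]$ of such intervals. For $x\in\mathbb{R}$ the standard decimal oracle is $o_x(l)=[a_l,b_l]$ with $a_l=\frac{\lfloor 10^{l+1}x\rfloor-c}{10^{l+1}}$, $b_l=\frac{\lfloor 10^{l+1}x\rfloor+1+c}{10^{l+1}}$. An oracle for $x$ in $(\mathcal{I}_{10,c},\iota)$ is $\phi:\mathbb{N}\to I$ such that $\{\iota(\phi(m))\}$ is a local basis for $x$ (each contains $x$ and every member of $\mathcal{I}_{10,c}$ containing $x$ contains one of them); nested means $\iota(\phi(m+1))\subseteq\iota(\phi(m))$. The $n$-fold effective product has basis elements $\iota(u_1)\times\cdots\times\iota(u_n)$ coded by $\langle u_1,\dots,u_n\rangle$; $R\subseteq\mathbb{N}$ is a basic representation of $Y\subseteq\mathbb{R}^n$ iff $R$ consists of such codes and for all $y\in\mathbb{R}^n$, $y\in Y$ iff some local basis of $y$ lies within the basis elements coded by $R$. Definition of $\mathcal{K}_{k,n,c}$: suppose $\psi:\mathbb{R}^k\to\mathbb{R}^{n-k}$ ($n>k$) and programs for partial recursive functionals $\kappa_1,\dots,\kappa_{n-k}$ (oracle machines with function arguments $\phi_1,\dots,\phi_k$ and input $m$) are such that whenever $\phi_1,\dots,\phi_k$ are nested oracles for $x_1,\dots,x_k$ in $(\mathcal{I}_{10,c},\iota)$, $\kappa_j(\phi_1,\dots,\phi_k,m)$ is defined for all $m$ and gives a nested oracle for $\varpi_j^{n-k}(\psi(x_1,\dots,x_k))$. For $u\in I$ with midpoint $p$ and $d$ digits of precision let $\sigma_u(l)=o_p(l)$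 if $l<d$ and undefined otherwise; $\kappa_j(\sigma_{u_1},\dots,\sigma_{u_k},m)$ is declared undefined if the program for $\kappa_j$ queries some $\sigma_{u_i}(l)$ that is undefined. Let $R$ be the set of all $\langle u_1,\dots,u_n\rangle$ with $u_i\in I$ for $i\le k$ and, for each $1\le j\le n-k$, $u_{k+j}=\kappa_j(\sigma_{u_1},\dots,\sigma_{u_k},m)$ for some $m\in\mathbb{N}$, and let $H=\{\pi_1^n,\dots,\pi_n^n\}$. Then $(R,H)$ is a basic representation of the model induced by $\psi$ (graph of $\psi$ with observables $\varpi_1^n,\dots,\varpi_n^n$), and $\mathcal{K}_{k,n,c}$ is the collection of all pairs $(R,H)$ obtained in this way. *)

theory Defs
  imports Complex_Main "HOL-Library.Nat_Bijection"
begin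

section \<open>Tuples of natural numbers\<close>

text \<open>\<^const>\<open>prod_encode\<close> is the Cantor pairing; tuples associate to the left.\<close>

lemma prod_encode_eq_Cantor:
  "prod_encode (x, y) = (x^2 + 2*x*y + y^2 + 3*x + y) div 2"
proof -
  have "(x^2 + 2*x*y + y^2 + 3*x + y) = (x + y) * Suc (x + y) + 2 * x"
    by (simp add: power2_eq_square algebra_simps)
  then show ?thesis
    by (simp add: prod_encode_def triangle_def)
qed

fun tuple_code :: "nat list \<Rightarrow> nat" where
  "tuple_code [] = 0"
| "tuple_code (x # xs) = foldl (\<lambda>a b. prod_encode (a, b)) x xs"

text \<open>Components are counted from \<open>0\<close>.\<close>

definition tuple_proj :: "nat \<Rightarrow> nat \<Rightarrow> nat \<Rightarrow> nat" where
  "tuple_proj n i z = (THE xs. length xs = n \<and> tuple_code xs = z) ! i"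

lemma tuple_code_snoc: "xs \<noteq> [] \<Longrightarrow> tuple_code (xs @ [x]) = prod_encode (tuple_code xs, x)"
  by (cases xs) auto

lemma tuple_code_inj:
  "length xs = length ys \<Longrightarrow> tuple_code xs = tuple_code ys \<Longrightarrow> xs = ys"
proof (induction xs arbitrary: ys rule: rev_induct)
  case (snoc x xs)
  then obtain zs z where ys: "ys = zs @ [z]" "length zs = length xs"
    by (cases ys rule: rev_cases) auto
  show ?case
  proof (cases "xs = []")
    case True
    then show ?thesis using snoc ys by simp
  next
    case False
    then have "zs \<noteq> []" using ys by auto
    then have "tuple_code xs = tuple_code zs \<and> x = z"
      using snoc.prems(2) False ys by (simp add: tuple_code_snoc)
    then show ?thesis using snoc.IH[of zs] ys by simp
  qed
qed simp

lemma tuple_proj_tuple_code: "tuple_proj (length xs) i (tuple_code xs) = xs ! i"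
proof -
  have "(THE ys. length ys = length xs \<and> tuple_code ys = tuple_code xs) = xs"
    by (rule the_equality) (auto intro: tuple_code_inj)
  then show ?thesis by (simp add: tuple_proj_def)
qed

lemma tuple_code_surj: "0 < n \<Longrightarrow> \<exists>xs. length xs = n \<and> tuple_code xs = z"
proof (induction n arbitrary: z)
  case (Suc n)
  show ?case
  proof (cases "n = 0")
    case True
    then show ?thesis by (intro exI[of _ "[z]"]) simp
  next
    case False
    obtain a b where ab: "z = prod_encode (a, b)"
      by (metis prod_decode_inverse surj_pair)
    obtain xs where "length xs = n" "tuple_code xs = a"
      using Suc.IH False by blast
    then show ?thesis
      using False ab by (intro exI[of _ "xs @ [b]"]) (auto simp: tuple_code_snoc)
  qed
qed simp

section \<open>Partial recursive functionals\<close>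

text \<open>
  Unlimited register machines with finitely many oracles.  \<open>Query i n\<close> replaces the content of
  register \<open>n\<close> by the answer of the \<open>i\<close>-th oracle to it.  Oracles may be partial: after a query
  without an answer there is no next configuration, and since only a program counter outside the
  program counts as halting, such a computation has no result.
\<close>

datatype instr =
    Zero nat
  | Succ nat
  | Transfer nat nat
  | Jump nat nat nat
  | Query nat nat

type_synonym program = "instr list"
type_synonym config = "nat \<times> (nat \<Rightarrow> nat)"

fun exec :: "(nat \<rightharpoonup> nat) list \<Rightarrow> instr \<Rightarrow> config \<Rightarrow> config option" where
  "exec \<phi>s (Zero n) (pc, r) = Some (Suc pc, r(n := 0))"
| "exec \<phi>s (Succ n) (pc, r) = Some (Suc pc, r(n := Suc (r n)))"
| "exec \<phi>s (Transfer m n) (pc, r) = Some (Suc pc, r(n := r m))"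
| "exec \<phi>s (Jump m n q) (pc, r) = Some (if r m = r n then q else Suc pc, r)"
| "exec \<phi>s (Query i n) (pc, r) =
     (if i < length \<phi>s then map_option (\<lambda>v. (Suc pc, r(n := v))) ((\<phi>s ! i) (r n)) else None)"

inductive step :: "program \<Rightarrow> (nat \<rightharpoonup> nat) list \<Rightarrow> config \<Rightarrow> config \<Rightarrow> bool"
  for P \<phi>s where
  "pc < length P \<Longrightarrow> exec \<phi>s (P ! pc) (pc, r) = Some s \<Longrightarrow> step P \<phi>s (pc, r) s"

definition halts_with :: "program \<Rightarrow> (nat \<rightharpoonup> nat) list \<Rightarrow> nat \<Rightarrow> nat \<Rightarrow> bool" where
  "halts_with P \<phi>s m v \<longleftrightarrow>
     (\<exists>pc r. (step P \<phi>s)\<^sup>*\<^sup>* (0, (\<lambda>_. 0)(0 := m)) (pc, r) \<and> length P \<le> pc \<and> r 0 = v)"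

definition run :: "program \<Rightarrow> (nat \<rightharpoonup> nat) list \<Rightarrow> nat \<Rightarrow> nat option" where
  "run P \<phi>s m = (if \<exists>v. halts_with P \<phi>s m v then Some (THE v. halts_with P \<phi>s m v) else None)"

lemma step_deterministic: "step P \<phi>s s t \<Longrightarrow> step P \<phi>s s t' \<Longrightarrow> t = t'"
  by (auto elim!: step.cases)

lemma step_halted: "length P \<le> pc \<Longrightarrow> \<not> step P \<phi>s (pc, r) t"
  by (auto elim!: step.cases)

lemma halted_unique:
  assumes "(step P \<phi>s)\<^sup>*\<^sup>* s t" "(step P \<phi>s)\<^sup>*\<^sup>* s t'" "length P \<le> fst t" "length P \<le> fst t'"
  shows "t = t'"
  using assms
proof (induction rule: converse_rtranclp_induct)
  case base
  then show ?case
    by (metis converse_rtranclpE prod.collapse step_halted)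
next
  case (step y z)
  then have "(Defs.step P \<phi>s)\<^sup>*\<^sup>* z t'"
    by (metis converse_rtranclpE prod.collapse step_deterministic step_halted)
  then show ?case using step by blast
qed

lemma halts_with_unique: "halts_with P \<phi>s m v \<Longrightarrow> halts_with P \<phi>s m w \<Longrightarrow> v = w"
  unfolding halts_with_def using halted_unique by (metis fst_conv prod.inject)

lemma run_eq_Some_iff: "run P \<phi>s m = Some v \<longleftrightarrow> halts_with P \<phi>s m v"
  unfolding run_def by (auto intro: halts_with_unique the_equality theI)

definition partial_recursive_functional ::
    "nat \<Rightarrow> ((nat \<Rightarrow> nat) list \<Rightarrow> nat \<Rightarrow> nat option) \<Rightarrow> bool" where
  "partial_recursive_functional k F \<longleftrightarrow>
     (\<exists>P. \<forall>\<phi>s m. length \<phi>s = k \<longrightarrow> F \<phi>s m = run P (map (\<lambda>\<phi>. Some \<circ> \<phi>) \<phi>s) m)"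

section \<open>Codes of rational and decimal intervals\<close>

text \<open>
  Every rational is presented as \<open>(a - b) / d\<close> with natural numbers \<open>a\<close>, \<open>b\<close> and \<open>d > 0\<close>; a coding is
  computable if the code can be computed from such a presentation (without any oracle).
\<close>

definition computable_rat_coding :: "(rat \<Rightarrow> nat) \<Rightarrow> bool" where
  "computable_rat_coding \<rho> \<longleftrightarrow>
     (\<exists>P. \<forall>a b d. d > 0 \<longrightarrow>
        run P [] (tuple_code [a, b, d]) = Some (\<rho> ((of_nat a - of_nat b) / of_nat d)))"

definition ivl_code :: "(rat \<Rightarrow> nat) \<Rightarrow> rat \<Rightarrow> rat \<Rightarrow> nat" where
  "ivl_code \<rho> a b = prod_encode (\<rho> a, \<rho> b)"

definition iota :: "(rat \<Rightarrow> nat) \<Rightarrow> nat \<Rightarrow> real set" where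
  "iota \<rho> u = {x. \<exists>a b. u = ivl_code \<rho> a b \<and> of_rat a < x \<and> x < of_rat b}"

definition dec_code :: "(rat \<Rightarrow> nat) \<Rightarrow> rat \<Rightarrow> int \<Rightarrow> nat \<Rightarrow> nat" where
  "dec_code \<rho> c m d = ivl_code \<rho> ((of_int m - c) / 10 ^ d) ((of_int m + 1 + c) / 10 ^ d)"

definition dec_codes :: "(rat \<Rightarrow> nat) \<Rightarrow> rat \<Rightarrow> nat set" where
  "dec_codes \<rho> c = {dec_code \<rho> c m d | m d. 0 < d}"

definition midpoint :: "(rat \<Rightarrow> nat) \<Rightarrow> nat \<Rightarrow> rat" where
  "midpoint \<rho> u = (THE p. \<exists>a b. u = ivl_code \<rho> a b \<and> p = (a + b) / 2)"

definition digits :: "(rat \<Rightarrow> nat) \<Rightarrow> rat \<Rightarrow> nat \<Rightarrow> nat" where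
  "digits \<rho> c u = (THE d. 0 < d \<and> (\<exists>m. u = dec_code \<rho> c m d))"

lemma ivl_code_eq_iff: "inj \<rho> \<Longrightarrow> ivl_code \<rho> a b = ivl_code \<rho> a' b' \<longleftrightarrow> a = a' \<and> b = b'"
  by (auto simp: ivl_code_def dest: injD)

lemma iota_ivl_code: "inj \<rho> \<Longrightarrow> iota \<rho> (ivl_code \<rho> a b) = {of_rat a<..<of_rat b}"
  by (auto simp: iota_def ivl_code_eq_iff)

lemma midpoint_ivl_code: "inj \<rho> \<Longrightarrow> midpoint \<rho> (ivl_code \<rho> a b) = (a + b) / 2"
  unfolding midpoint_def by (rule the_equality) (auto simp: ivl_code_eq_iff)

lemma digits_dec_code:
  assumes "inj \<rho>" "0 < c" "0 < d"
  shows "digits \<rho> c (dec_code \<rho> c m d) = d"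
  unfolding digits_def
proof (rule the_equality)
  fix e assume "0 < e \<and> (\<exists>m'. dec_code \<rho> c m d = dec_code \<rho> c m' e)"
  then obtain m' where
    "(of_int m - c) / 10 ^ d = (of_int m' - c) / 10 ^ e"
    "(of_int m + 1 + c) / 10 ^ d = (of_int m' + 1 + c) / 10 ^ e"
    using assms(1) by (auto simp: dec_code_def ivl_code_eq_iff)
  then have "(of_int m + 1 + c) / 10 ^ d - (of_int m - c) / 10 ^ d =
      (of_int m' + 1 + c) / 10 ^ e - (of_int m' - c) / 10 ^ e"
    by (simp only:)
  then have "(1 + 2 * c) / 10 ^ d = (1 + 2 * c) / 10 ^ e"
    by (simp add: diff_divide_distrib [symmetric] del: power_inject_exp)
  moreover have "1 + 2 * c \<noteq> 0" using assms(2) by simp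
  ultimately have "(10::rat) ^ d = 10 ^ e"
    by (simp add: divide_cancel_left del: power_inject_exp)
  then show "e = d" by simp
qed (use assms in auto)

section \<open>Oracles for real numbers\<close>

definition local_basis :: "'a set set \<Rightarrow> 'a \<Rightarrow> 'a set set \<Rightarrow> bool" where
  "local_basis \<B> x L \<longleftrightarrow>
     L \<subseteq> \<B> \<and> (\<forall>U\<in>L. x \<in> U) \<and> (\<forall>V\<in>\<B>. x \<in> V \<longrightarrow> (\<exists>U\<in>L. U \<subseteq> V))"

definition oracle_for :: "(rat \<Rightarrow> nat) \<Rightarrow> rat \<Rightarrow> real \<Rightarrow> (nat \<Rightarrow> nat) \<Rightarrow> bool" where
  "oracle_for \<rho> c x \<phi> \<longleftrightarrow>
     range \<phi> \<subseteq> dec_codes \<rho> c \<and>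
     local_basis (iota \<rho> ` dec_codes \<rho> c) x (range (\<lambda>m. iota \<rho> (\<phi> m)))"

definition nested_oracle_for :: "(rat \<Rightarrow> nat) \<Rightarrow> rat \<Rightarrow> real \<Rightarrow> (nat \<Rightarrow> nat) \<Rightarrow> bool" where
  "nested_oracle_for \<rho> c x \<phi> \<longleftrightarrow>
     oracle_for \<rho> c x \<phi> \<and> (\<forall>m. iota \<rho> (\<phi> (Suc m)) \<subseteq> iota \<rho> (\<phi> m))"

definition std_oracle :: "(rat \<Rightarrow> nat) \<Rightarrow> rat \<Rightarrow> real \<Rightarrow> nat \<Rightarrow> nat" where
  "std_oracle \<rho> c x l = dec_code \<rho> c \<lfloor>10 ^ (l + 1) * x\<rfloor> (l + 1)"

definition partial_std_oracle :: "(rat \<Rightarrow> nat) \<Rightarrow> rat \<Rightarrow> nat \<Rightarrow> (nat \<rightharpoonup> nat)" where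
  "partial_std_oracle \<rho> c u l =
     (if l < digits \<rho> c u then Some (std_oracle \<rho> c (of_rat (midpoint \<rho> u)) l) else None)"

section \<open>Basic representations\<close>

text \<open>Points of \<open>\<real>\<^sup>n\<close> are lists of length \<open>n\<close>.\<close>

definition box :: "(rat \<Rightarrow> nat) \<Rightarrow> nat list \<Rightarrow> real list set" where
  "box \<rho> us = {y. list_all2 (\<lambda>t u. t \<in> iota \<rho> u) y us}"

definition box_tuples :: "(rat \<Rightarrow> nat) \<Rightarrow> rat \<Rightarrow> nat \<Rightarrow> nat list set" where
  "box_tuples \<rho> c n = {us. length us = n \<and> set us \<subseteq> dec_codes \<rho> c}"

definition basic_representation ::
    "(rat \<Rightarrow> nat) \<Rightarrow> rat \<Rightarrow> nat \<Rightarrow> nat set \<Rightarrow> real list set \<Rightarrow> bool" where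
  "basic_representation \<rho> c n R Y \<longleftrightarrow>
     Y \<subseteq> {y. length y = n} \<and>
     R \<subseteq> tuple_code ` box_tuples \<rho> c n \<and>
     (\<forall>y. length y = n \<longrightarrow>
        (y \<in> Y \<longleftrightarrow>
          (\<exists>L. local_basis (box \<rho> ` box_tuples \<rho> c n) y L \<and>
               L \<subseteq> box \<rho> ` {us \<in> box_tuples \<rho> c n. tuple_code us \<in> R})))"

definition graph_of :: "nat \<Rightarrow> (real list \<Rightarrow> real list) \<Rightarrow> real list set" where
  "graph_of k \<psi> = {xs @ \<psi> xs | xs. length xs = k}"

section \<open>The class of pairs \<open>(R, H)\<close>\<close>

text \<open>
  A pair is given by programs \<open>Ps\<close> whose functionals compute the components of a function
  \<open>\<psi> : \<real>\<^sup>k \<rightarrow> \<real>\<^sup>n\<^sup>-\<^sup>k\<close> on nested oracles.  For the set \<open>R\<close> the same programs are run on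
  the finite initial parts of the standard decimal oracles of the midpoints, so it depends on the
  programs and not only on the functionals.
\<close>

definition computes_nested_oracles ::
    "(rat \<Rightarrow> nat) \<Rightarrow> rat \<Rightarrow> nat \<Rightarrow> ((nat \<Rightarrow> nat) list \<Rightarrow> nat \<Rightarrow> nat option)
      \<Rightarrow> (real list \<Rightarrow> real) \<Rightarrow> bool" where
  "computes_nested_oracles \<rho> c k F f \<longleftrightarrow>
     (\<forall>\<phi>s xs. length \<phi>s = k \<and> length xs = k \<and>
        (\<forall>i<k. nested_oracle_for \<rho> c (xs ! i) (\<phi>s ! i)) \<longrightarrow>
        (\<forall>m. F \<phi>s m \<noteq> None) \<and> nested_oracle_for \<rho> c (f xs) (\<lambda>m. the (F \<phi>s m)))"

definition rep_set ::
    "(rat \<Rightarrow> nat) \<Rightarrow> rat \<Rightarrow> nat \<Rightarrow> nat \<Rightarrow> program list \<Rightarrow> nat set" where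
  "rep_set \<rho> c k n Ps =
     {tuple_code us | us. length us = n \<and> (\<forall>i<k. us ! i \<in> dec_codes \<rho> c) \<and>
        (\<forall>j<n-k. \<exists>m. run (Ps ! j) (map (partial_std_oracle \<rho> c) (take k us)) m
                       = Some (us ! (k + j)))}"

definition K_class ::
    "(rat \<Rightarrow> nat) \<Rightarrow> nat \<Rightarrow> nat \<Rightarrow> rat \<Rightarrow> (nat set \<times> (nat \<Rightarrow> nat) set) set" where
  "K_class \<rho> k n c =
     {(rep_set \<rho> c k n Ps, tuple_proj n ` {..<n}) | Ps (\<psi> :: real list \<Rightarrow> real list).
        (\<forall>xs. length xs = k \<longrightarrow> length (\<psi> xs) = n - k) \<and>
        length Ps = n - k \<and>
        (\<forall>j<n-k. computes_nested_oracles \<rho> c k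
           (\<lambda>\<phi>s. run (Ps ! j) (map (\<lambda>\<phi>. Some \<circ> \<phi>) \<phi>s)) (\<lambda>xs. \<psi> xs ! j))}"

end

(*
  Let \<psi>' be the function computed by the programs behind R.  Every point of its graph has a local
  basis among the boxes coded by R, so it lies on the graph of \<psi>; hence \<psi> = \<psi>' and the programs
  themselves compute nested oracles for \<psi>.  To find the boxes, truncate the standard decimal oracle
  of x after N digits: this gives an interval u whose partial oracle \<sigma>_u consists of the first N
  answers of that oracle.  A halting computation makes finitely many queries, so for large N it runs
  in the same way on the partial oracles.
*)
theory Submission
  imports Defs
begin

lemma eventually_step:
  assumes "step P \<phi>s s t"
    and "\<And>N. length (\<sigma>s N) = length \<phi>s"
    and "\<And>i l. i < length \<phi>s \<Longrightarrow> \<forall>\<^sub>F N in F. (\<sigma>s N ! i) l = (\<phi>s ! i) l"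
  shows "\<forall>\<^sub>F N in F. step P (\<sigma>s N) s t"
  using assms(1)
proof cases
  case (1 pc r)
  have "\<forall>\<^sub>F N in F. exec (\<sigma>s N) (P ! pc) (pc, r) = Some t"
  proof (cases "P ! pc")
    case (Query i n)
    with 1 have i: "i < length \<phi>s" by (auto split: if_splits)
    from assms(3)[OF i, of "r n"] show ?thesis
      by eventually_elim (use 1 Query i assms(2) in auto)
  qed (use 1 in auto)
  then show ?thesis
    by eventually_elim (use 1 in \<open>auto intro: step.intros\<close>)
qed

lemma eventually_steps:
  assumes "(step P \<phi>s)\<^sup>*\<^sup>* s t"
    and "\<And>N. length (\<sigma>s N) = length \<phi>s"
    and "\<And>i l. i < length \<phi>s \<Longrightarrow> \<forall>\<^sub>F N in F. (\<sigma>s N ! i) l = (\<phi>s ! i) l"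
  shows "\<forall>\<^sub>F N in F. (step P (\<sigma>s N))\<^sup>*\<^sup>* s t"
  using assms(1)
proof (induction rule: rtranclp_induct)
  case (step t u)
  have "\<forall>\<^sub>F N in F. Defs.step P (\<sigma>s N) t u"
    by (rule eventually_step[OF step.hyps(2) assms(2,3)])
  with step.IH show ?case
    by eventually_elim (rule rtranclp.rtrancl_into_rtrancl)
qed simp

lemma eventually_run:
  assumes "run P \<phi>s m = Some v"
    and "\<And>N. length (\<sigma>s N) = length \<phi>s"
    and "\<And>i l. i < length \<phi>s \<Longrightarrow> \<forall>\<^sub>F N in F. (\<sigma>s N ! i) l = (\<phi>s ! i) l"
  shows "\<forall>\<^sub>F N in F. run P (\<sigma>s N) m = Some v"
proof -
  obtain pc r where steps: "(step P \<phi>s)\<^sup>*\<^sup>* (0, (\<lambda>_. 0)(0 := m)) (pc, r)" and halt: "length P \<le> pc" "r 0 = v"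
    using assms(1) by (auto simp: run_eq_Some_iff halts_with_def)
  have "\<forall>\<^sub>F N in F. (step P (\<sigma>s N))\<^sup>*\<^sup>* (0, (\<lambda>_. 0)(0 := m)) (pc, r)"
    by (rule eventually_steps[OF steps assms(2,3)])
  then show ?thesis
    by eventually_elim (use halt in \<open>auto simp: run_eq_Some_iff halts_with_def\<close>)
qed

lemma iota_dec_code:
  assumes "inj \<rho>"
  shows "iota \<rho> (dec_code \<rho> c m d) =
    {(of_int m - of_rat c) / 10 ^ d <..< (of_int m + 1 + of_rat c) / 10 ^ d}"
  using assms by (simp add: dec_code_def iota_ivl_code of_rat_divide of_rat_diff of_rat_add of_rat_power)

lemma std_oracle_in_dec_codes: "std_oracle \<rho> c x l \<in> dec_codes \<rho> c"
  by (auto simp: std_oracle_def dec_codes_def)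

lemma mem_std_oracle:
  assumes "inj \<rho>" "0 < c"
  shows "x \<in> iota \<rho> (std_oracle \<rho> c x l)"
proof -
  have "0 < real_of_rat c" using assms(2) by simp
  then have "of_int \<lfloor>10 ^ (l + 1) * x\<rfloor> - of_rat c < 10 ^ (l + 1) * x"
    "10 ^ (l + 1) * x < of_int \<lfloor>10 ^ (l + 1) * x\<rfloor> + 1 + of_rat c"
    by linarith+
  then show ?thesis
    unfolding std_oracle_def iota_dec_code[OF assms(1)]
    by (simp add: pos_divide_less_eq pos_less_divide_eq mult.commute)
qed

lemma std_oracle_nested:
  assumes "inj \<rho>" "0 < c"
  shows "iota \<rho> (std_oracle \<rho> c x (Suc l)) \<subseteq> iota \<rho> (std_oracle \<rho> c x l)"
proof -
  define q :: real where "q = 10 ^ (l + 1)"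
  define y where "y = q * x"
  have q: "q > 0" by (simp add: q_def)
  have c: "0 < real_of_rat c" using assms(2) by simp
  have "10 * \<lfloor>y\<rfloor> \<le> \<lfloor>10 * y\<rfloor>" "\<lfloor>10 * y\<rfloor> + 1 \<le> 10 * \<lfloor>y\<rfloor> + 10" by linarith+
  then have "10 * real_of_int \<lfloor>y\<rfloor> \<le> of_int \<lfloor>10 * y\<rfloor>"
    "real_of_int \<lfloor>10 * y\<rfloor> + 1 \<le> 10 * of_int \<lfloor>y\<rfloor> + 10" by linarith+
  with c have le: "10 * (of_int \<lfloor>y\<rfloor> - of_rat c) \<le> of_int \<lfloor>10 * y\<rfloor> - real_of_rat c"
    "real_of_int \<lfloor>10 * y\<rfloor> + 1 + of_rat c \<le> 10 * (of_int \<lfloor>y\<rfloor> + 1 + of_rat c)"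
    unfolding right_diff_distrib distrib_left by linarith+
  have "(of_int \<lfloor>y\<rfloor> - of_rat c) / q \<le> (of_int \<lfloor>10 * y\<rfloor> - real_of_rat c) / (10 * q)"
    using divide_right_mono[OF le(1), of "10 * q"] q
    by (simp del: right_diff_distrib_numeral)
  moreover have "(real_of_int \<lfloor>10 * y\<rfloor> + 1 + of_rat c) / (10 * q) \<le> (of_int \<lfloor>y\<rfloor> + 1 + of_rat c) / q"
    using divide_right_mono[OF le(2), of "10 * q"] q
    by (simp del: distrib_left_numeral)
  moreover have Suc: "(10::real) ^ (Suc l + 1) = 10 * q"
    by (simp add: q_def)
  ultimately show ?thesis
    unfolding std_oracle_def iota_dec_code[OF assms(1)] Suc q_def[symmetric] mult.assoc y_def[symmetric]
    by (intro greaterThanLessThan_subseteq_greaterThanLessThan[THEN iffD2] impI conjI)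
qed

lemma eventually_std_oracle_subset:
  assumes "inj \<rho>" "0 < c" "a < x" "x < b"
  shows "\<forall>\<^sub>F l in sequentially. iota \<rho> (std_oracle \<rho> c x l) \<subseteq> {a<..<b}"
proof -
  define e where "e = min (x - a) (b - x)"
  have "(\<lambda>l. (1 + real_of_rat c) * (1 / 10) ^ (l + 1)) \<longlonglongrightarrow> (1 + real_of_rat c) * 0"
    by (intro tendsto_mult tendsto_const LIMSEQ_ignore_initial_segment LIMSEQ_power_zero) simp
  moreover have "e > 0" using assms by (simp add: e_def)
  ultimately have "\<forall>\<^sub>F l in sequentially. (1 + real_of_rat c) * (1 / 10) ^ (l + 1) < e"
    unfolding mult_zero_right by (rule order_tendstoD(2))
  then show ?thesis
  proof eventually_elim
    case (elim l)
    define q :: real where "q = 10 ^ (l + 1)"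
    have q: "q > 0" by (simp add: q_def)
    have "(1 + real_of_rat c) / q < e" using elim by (simp add: q_def power_divide)
    then have e: "1 + real_of_rat c < q * e" using q by (simp add: field_simps)
    have "q * e \<le> q * (x - a)" "q * e \<le> q * (b - x)" using q by (simp_all add: e_def)
    with e have "q * a < of_int \<lfloor>q * x\<rfloor> - of_rat c" "of_int \<lfloor>q * x\<rfloor> + 1 + of_rat c < q * b"
      unfolding right_diff_distrib by linarith+
    then have "a < (of_int \<lfloor>q * x\<rfloor> - of_rat c) / q" "(of_int \<lfloor>q * x\<rfloor> + 1 + of_rat c) / q < b"
      using q by (simp_all add: field_simps)
    then show ?case
      unfolding std_oracle_def iota_dec_code[OF assms(1)] q_def[symmetric] by auto
  qed
qed

lemma eventually_std_oracle_subset_iota: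
  assumes "inj \<rho>" "0 < c" "v \<in> dec_codes \<rho> c" "x \<in> iota \<rho> v"
  shows "\<forall>\<^sub>F l in sequentially. iota \<rho> (std_oracle \<rho> c x l) \<subseteq> iota \<rho> v"
proof -
  obtain m d where v: "v = dec_code \<rho> c m d" using assms(3) by (auto simp: dec_codes_def)
  show ?thesis
    using eventually_std_oracle_subset[OF assms(1,2)] assms(4)
    unfolding v iota_dec_code[OF assms(1)] by simp
qed

lemma nested_oracle_for_std_oracle:
  assumes "inj \<rho>" "0 < c"
  shows "nested_oracle_for \<rho> c x (std_oracle \<rho> c x)"
proof -
  have "\<exists>l. iota \<rho> (std_oracle \<rho> c x l) \<subseteq> iota \<rho> v" if "v \<in> dec_codes \<rho> c" "x \<in> iota \<rho> v" for v
    using eventually_std_oracle_subset_iota[OF assms that]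
    by (rule eventually_happens'[OF sequentially_bot])
  then show ?thesis
    using assms by (auto simp: nested_oracle_for_def oracle_for_def local_basis_def
        std_oracle_in_dec_codes std_oracle_nested[THEN subsetD] mem_std_oracle)
qed

lemma partial_std_oracle_std_oracle:
  assumes "inj \<rho>" "0 < c" "l \<le> N"
  shows "partial_std_oracle \<rho> c (std_oracle \<rho> c x N) l = Some (std_oracle \<rho> c x l)"
proof -
  define m where "m = \<lfloor>10 ^ (N + 1) * x\<rfloor>"
  define p :: real where "p = of_rat (midpoint \<rho> (std_oracle \<rho> c x N))"
  have p: "10 ^ (N + 1) * p = of_int m + 1 / 2"
    using assms(1) unfolding p_def m_def
    by (simp add: std_oracle_def dec_code_def midpoint_ivl_code of_rat_divide of_rat_diff
        of_rat_add of_rat_mult of_rat_power add_divide_distrib[symmetric] diff_divide_distrib[symmetric] field_simps)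
  have scale: "\<lfloor>10 ^ (l + 1) * t\<rfloor> = \<lfloor>10 ^ (N + 1) * t\<rfloor> div 10 ^ (N - l)" for t :: real
  proof -
    have "(10::real) ^ (N + 1) = 10 ^ (l + 1) * 10 ^ (N - l)"
      using assms(3) by (simp flip: power_add)
    then have "10 ^ (l + 1) * t = 10 ^ (N + 1) * t / of_int (10 ^ (N - l))" by simp
    then show ?thesis by (simp only: floor_divide_real_eq_div zero_le_power zero_le_numeral)
  qed
  have "\<lfloor>10 ^ (N + 1) * p\<rfloor> = \<lfloor>10 ^ (N + 1) * x\<rfloor>"
    unfolding p m_def[symmetric] by linarith
  then have "std_oracle \<rho> c p l = std_oracle \<rho> c x l"
    by (simp only: std_oracle_def scale)
  moreover have "digits \<rho> c (std_oracle \<rho> c x N) = N + 1"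
    unfolding std_oracle_def by (rule digits_dec_code) (use assms in auto)
  ultimately show ?thesis
    using assms(3) by (simp add: partial_std_oracle_def p_def)
qed

lemma rep_set_local_basis:
  assumes "inj \<rho>" "0 < c" "k \<le> n" "length xs = k" "length ys = n - k"
    and \<kappa>: "\<And>j. j < n - k \<Longrightarrow> nested_oracle_for \<rho> c (ys ! j) (\<kappa> j)"
    and run: "\<And>j m. j < n - k \<Longrightarrow>
      run (Ps ! j) (map (\<lambda>x. Some \<circ> std_oracle \<rho> c x) xs) m = Some (\<kappa> j m)"
    and vs: "vs \<in> box_tuples \<rho> c n" "xs @ ys \<in> box \<rho> vs"
  shows "\<exists>us\<in>box_tuples \<rho> c n.
    tuple_code us \<in> rep_set \<rho> c k n Ps \<and> xs @ ys \<in> box \<rho> us \<and> box \<rho> us \<subseteq> box \<rho> vs"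
proof -
  have vs_dec: "vs ! i \<in> dec_codes \<rho> c" if "i < n" for i
    using vs(1) that by (auto simp: box_tuples_def)
  have len: "length vs = n" using vs(1) by (simp add: box_tuples_def)
  have vs_mem: "(xs @ ys) ! i \<in> iota \<rho> (vs ! i)" if "i < n" for i
    using vs(2) that len by (simp add: box_def list_all2_conv_all_nth)
  have "\<exists>m. iota \<rho> (\<kappa> j m) \<subseteq> iota \<rho> (vs ! (k + j))" if "j < n - k" for j
    using \<kappa>[OF that] vs_dec[of "k + j"] vs_mem[of "k + j"] that assms(4)
    by (fastforce simp: nested_oracle_for_def oracle_for_def local_basis_def nth_append)
  then obtain \<mu> where \<mu>: "\<And>j. j < n - k \<Longrightarrow> iota \<rho> (\<kappa> j (\<mu> j)) \<subseteq> iota \<rho> (vs ! (k + j))"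
    by metis
  have \<kappa>_dec: "\<kappa> j m \<in> dec_codes \<rho> c" and \<kappa>_mem: "ys ! j \<in> iota \<rho> (\<kappa> j m)" if "j < n - k" for j m
    using \<kappa>[OF that] by (auto simp: nested_oracle_for_def oracle_for_def local_basis_def)
  define ws where "ws N = map (\<lambda>x. std_oracle \<rho> c x N) xs" for N
  have "\<forall>\<^sub>F N in sequentially. run (Ps ! j) (map (partial_std_oracle \<rho> c) (ws N)) (\<mu> j) = Some (\<kappa> j (\<mu> j))"
    if "j < n - k" for j
  proof (rule eventually_run[OF run[OF that]])
    fix i l assume "i < length (map (\<lambda>x. Some \<circ> std_oracle \<rho> c x) xs)"
    then show "\<forall>\<^sub>F N in sequentially. (map (partial_std_oracle \<rho> c) (ws N) ! i) l =
        (map (\<lambda>x. Some \<circ> std_oracle \<rho> c x) xs ! i) l"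
      by (intro eventually_mono[OF eventually_ge_at_top[of l]])
        (simp add: ws_def partial_std_oracle_std_oracle assms(1,2))
  qed (simp add: ws_def)
  then have "\<forall>\<^sub>F N in sequentially. \<forall>j\<in>{..<n-k}.
      run (Ps ! j) (map (partial_std_oracle \<rho> c) (ws N)) (\<mu> j) = Some (\<kappa> j (\<mu> j))"
    by (intro eventually_ball_finite) auto
  moreover have "\<forall>\<^sub>F N in sequentially. \<forall>i\<in>{..<k}. iota \<rho> (std_oracle \<rho> c (xs ! i) N) \<subseteq> iota \<rho> (vs ! i)"
  proof (intro eventually_ball_finite ballI)
    fix i assume "i \<in> {..<k}"
    then show "\<forall>\<^sub>F N in sequentially. iota \<rho> (std_oracle \<rho> c (xs ! i) N) \<subseteq> iota \<rho> (vs ! i)"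
      using vs_dec[of i] vs_mem[of i] assms(1-4)
      by (intro eventually_std_oracle_subset_iota) (auto simp: nth_append)
  qed simp
  ultimately have "\<forall>\<^sub>F N in sequentially.
      (\<forall>j\<in>{..<n-k}. run (Ps ! j) (map (partial_std_oracle \<rho> c) (ws N)) (\<mu> j) = Some (\<kappa> j (\<mu> j))) \<and>
      (\<forall>i\<in>{..<k}. iota \<rho> (std_oracle \<rho> c (xs ! i) N) \<subseteq> iota \<rho> (vs ! i))"
    by (rule eventually_conj)
  then obtain N where
    N_run: "\<And>j. j < n - k \<Longrightarrow>
      run (Ps ! j) (map (partial_std_oracle \<rho> c) (ws N)) (\<mu> j) = Some (\<kappa> j (\<mu> j))"
    and N_sub: "\<And>i. i < k \<Longrightarrow> iota \<rho> (std_oracle \<rho> c (xs ! i) N) \<subseteq> iota \<rho> (vs ! i)"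
    by (auto dest!: eventually_happens'[OF sequentially_bot])
  define us where "us = ws N @ map (\<lambda>j. \<kappa> j (\<mu> j)) [0..<n-k]"
  have ws_len: "length (ws N) = k" using assms(4) by (simp add: ws_def)
  then have us_len: "length us = n" using assms(3) by (simp add: us_def)
  have us_left: "us ! i = std_oracle \<rho> c (xs ! i) N" if "i < k" for i
    using that assms(4) by (simp add: us_def ws_def nth_append)
  have us_right: "us ! (k + j) = \<kappa> j (\<mu> j)" if "j < n - k" for j
    using that nth_append_length_plus[of "ws N" _ j] by (simp add: us_def ws_len)
  have nth: "us ! i \<in> dec_codes \<rho> c \<and> (xs @ ys) ! i \<in> iota \<rho> (us ! i) \<and> iota \<rho> (us ! i) \<subseteq> iota \<rho> (vs ! i)"
    if "i < n" for i
  proof (cases "i < k")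
    case True
    then show ?thesis
      using N_sub assms(1,2,4)
      by (simp add: us_left nth_append std_oracle_in_dec_codes mem_std_oracle)
  next
    case False
    define j where "j = i - k"
    have j: "i = k + j" "j < n - k" using False that by (simp_all add: j_def)
    have "(xs @ ys) ! i = ys ! j"
      using nth_append_length_plus[of xs ys j] assms(4) j(1) by simp
    moreover have "us ! i = \<kappa> j (\<mu> j)" unfolding j(1) by (rule us_right[OF j(2)])
    ultimately show ?thesis
      using \<mu>[OF j(2)] \<kappa>_dec[OF j(2)] \<kappa>_mem[OF j(2)] unfolding j(1) by metis
  qed
  have "us \<in> box_tuples \<rho> c n"
    using nth us_len by (auto simp: box_tuples_def in_set_conv_nth)
  moreover have "tuple_code us \<in> rep_set \<rho> c k n Ps"
  proof -
    have "take k us = ws N" using assms(4) by (simp add: us_def ws_def)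
    then have "\<forall>j<n-k. \<exists>m. run (Ps ! j) (map (partial_std_oracle \<rho> c) (take k us)) m = Some (us ! (k + j))"
      using N_run us_right by auto
    moreover have "\<forall>i<k. us ! i \<in> dec_codes \<rho> c" using nth assms(3) by simp
    ultimately show ?thesis unfolding rep_set_def using us_len by blast
  qed
  moreover have "xs @ ys \<in> box \<rho> us"
    using nth us_len assms(3-5) by (simp add: box_def list_all2_conv_all_nth)
  moreover have "box \<rho> us \<subseteq> box \<rho> vs"
    unfolding box_def list_all2_conv_all_nth us_len len using nth by blast
  ultimately show ?thesis by blast
qed

lemma basic_representation_memI:
  assumes "basic_representation \<rho> c n R Y" "length y = n"
    and "\<And>vs. vs \<in> box_tuples \<rho> c n \<Longrightarrow> y \<in> box \<rho> vs \<Longrightarrow>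
      \<exists>us\<in>box_tuples \<rho> c n. tuple_code us \<in> R \<and> y \<in> box \<rho> us \<and> box \<rho> us \<subseteq> box \<rho> vs"
  shows "y \<in> Y"
proof -
  define L where "L = box \<rho> ` {us \<in> box_tuples \<rho> c n. tuple_code us \<in> R \<and> y \<in> box \<rho> us}"
  have "local_basis (box \<rho> ` box_tuples \<rho> c n) y L"
    unfolding local_basis_def
  proof (intro conjI ballI impI)
    fix V assume "V \<in> box \<rho> ` box_tuples \<rho> c n" "y \<in> V"
    then obtain vs where "V = box \<rho> vs" "vs \<in> box_tuples \<rho> c n" "y \<in> box \<rho> vs" by auto
    with assms(3) show "\<exists>U\<in>L. U \<subseteq> V" unfolding L_def by (metis (mono_tags, lifting) imageI mem_Collect_eq)
  qed (auto simp: L_def)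
  moreover have "L \<subseteq> box \<rho> ` {us \<in> box_tuples \<rho> c n. tuple_code us \<in> R}"
    by (auto simp: L_def)
  moreover have "y \<in> Y \<longleftrightarrow> (\<exists>L. local_basis (box \<rho> ` box_tuples \<rho> c n) y L \<and>
      L \<subseteq> box \<rho> ` {us \<in> box_tuples \<rho> c n. tuple_code us \<in> R})"
    by (rule assms(1)[unfolded basic_representation_def, THEN conjunct2, THEN conjunct2,
          THEN spec, THEN mp, OF assms(2)])
  ultimately show ?thesis by blast
qed

theorem theorem15:
  fixes \<rho> :: "rat \<Rightarrow> nat" and c :: rat and k n :: nat
    and R :: "nat set" and H :: "(nat \<Rightarrow> nat) set"
    and \<psi> :: "real list \<Rightarrow> real list"
  assumes "inj \<rho>" and "computable_rat_coding \<rho>"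
    and "0 < c" and "k < n"
    and "(R, H) \<in> K_class \<rho> k n c"
    and "\<And>xs. length xs = k \<Longrightarrow> length (\<psi> xs) = n - k"
    and "basic_representation \<rho> c n R (graph_of k \<psi>)"
  shows "\<exists>\<kappa>' :: nat \<Rightarrow> (nat \<Rightarrow> nat) list \<Rightarrow> nat \<Rightarrow> nat option.
    (\<forall>j<n-k. partial_recursive_functional k (\<kappa>' j)) \<and>
    (\<forall>\<phi>s xs. length \<phi>s = k \<and> length xs = k \<and>
        (\<forall>i<k. nested_oracle_for \<rho> c (xs ! i) (\<phi>s ! i)) \<longrightarrow>
      (\<forall>j<n-k. (\<forall>m. \<kappa>' j \<phi>s m \<noteq> None) \<and>
        nested_oracle_for \<rho> c (\<psi> xs ! j) (\<lambda>m. the (\<kappa>' j \<phi>s m))))"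
proof -
  obtain Ps and \<psi>' :: "real list \<Rightarrow> real list" where R: "R = rep_set \<rho> c k n Ps"
    and len': "\<And>xs. length xs = k \<Longrightarrow> length (\<psi>' xs) = n - k"
    and comp: "\<And>j. j < n - k \<Longrightarrow> computes_nested_oracles \<rho> c k
      (\<lambda>\<phi>s. run (Ps ! j) (map (\<lambda>\<phi>. Some \<circ> \<phi>) \<phi>s)) (\<lambda>xs. \<psi>' xs ! j)"
    using assms(5) unfolding K_class_def by blast
  have eq: "\<psi> xs = \<psi>' xs" if xs: "length xs = k" for xs
  proof -
    let ?F = "\<lambda>j. run (Ps ! j) (map (\<lambda>x. Some \<circ> std_oracle \<rho> c x) xs)"
    have F: "(\<forall>m. ?F j m \<noteq> None) \<and> nested_oracle_for \<rho> c (\<psi>' xs ! j) (\<lambda>m. the (?F j m))"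
      if "j < n - k" for j
    proof -
      have "\<forall>i<k. nested_oracle_for \<rho> c (xs ! i) (map (std_oracle \<rho> c) xs ! i)"
        using xs assms(1,3) by (simp add: nested_oracle_for_std_oracle)
      moreover have "length (map (std_oracle \<rho> c) xs) = k" using xs by simp
      moreover have "map (\<lambda>\<phi>. Some \<circ> \<phi>) (map (std_oracle \<rho> c) xs) = map (\<lambda>x. Some \<circ> std_oracle \<rho> c x) xs"
        by simp
      ultimately show ?thesis
        using comp[OF that] xs unfolding computes_nested_oracles_def by metis
    qed
    have "xs @ \<psi>' xs \<in> graph_of k \<psi>"
    proof (rule basic_representation_memI[OF assms(7)])
      show "length (xs @ \<psi>' xs) = n" using xs len' assms(4) by simp
    next
      fix vs assume "vs \<in> box_tuples \<rho> c n" "xs @ \<psi>' xs \<in> box \<rho> vs"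
      then show "\<exists>us\<in>box_tuples \<rho> c n.
          tuple_code us \<in> R \<and> xs @ \<psi>' xs \<in> box \<rho> us \<and> box \<rho> us \<subseteq> box \<rho> vs"
        unfolding R using F assms(1,3,4) xs len'[OF xs]
        by (intro rep_set_local_basis[where \<kappa> = "\<lambda>j m. the (?F j m)"]) auto
    qed
    then show ?thesis using xs by (auto simp: graph_of_def)
  qed
  show ?thesis
  proof (intro exI conjI)
    show "\<forall>j<n-k. partial_recursive_functional k
        (\<lambda>\<phi>s. run (Ps ! j) (map (\<lambda>\<phi>. Some \<circ> \<phi>) \<phi>s))"
      by (auto simp: partial_recursive_functional_def)
  qed (use comp eq in \<open>auto simp: computes_nested_oracles_def\<close>)
qed

end
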